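(* Let $L$ be an extremal odd unimodular lattice in dimension $40$ with theta series $\theta_{40,L,\alpha}$, so that $\alpha$ is the number of vectors of norm $2$ in the shadow of $L$. Then $\alpha$ is even and $0\le\alpha\le 80$.
   Context: A lattice $L\subset\mathbb{R}^n$ is unimodular if $L=L^*$, where $L^*$ is the dual lattice; the norm of $x$ is $(x,x)$. A unimodular lattice is even if all norms are even and odd otherwise. A unimodular lattice in dimension $40$ is extremal if its minimum norm is $4$. For an odd unimodular lattice $L$, let $L_0$ be its sublattice of vectors of even norm (of index $2$); the shadow of $L$ is $S=L_0^*\setminus L$. The theta series of a set $X$ is $\sum_{x\in X}q^{(x,x)}$. For an extremal odd unimodular lattice $L$ in dimension $40$ with shadow $S$, the theta series of $L$ and $S$ are of the form $$\theta_{40,L,\alpha}=1+(19120+256\alpha)q^4+(1376256-4096\alpha)q^5+\cdots,$$ $$\theta_{40,S,\alpha}=\alpha q^2+(40960-56\alpha)q^4+(87818240+1500\alpha)q^6+\cdots,$$ where $\alpha$ is an integer that determines both series. *)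

theory Defs
  imports "HOL-Analysis.Analysis"
begin

text \<open>Throughout, the ``norm'' of a vector \<open>x\<close> in the sense of lattice theory is \<open>x \<bullet> x\<close>,
  not the Euclidean length \<open>norm x\<close>.\<close>

text \<open>Lattices have full rank; the set \<open>B\<close> below is finite, being linearly independent.\<close>

definition lattice_in :: "(real ^ 'n) set \<Rightarrow> bool" where
  "lattice_in L \<longleftrightarrow>
     (\<exists>B. independent B \<and> span B = UNIV \<and>
          L = {(\<Sum>b\<in>B. of_int (c b) *\<^sub>R b) | c :: real ^ 'n \<Rightarrow> int. True})"

definition dual_lattice :: "(real ^ 'n) set \<Rightarrow> (real ^ 'n) set" where
  "dual_lattice L = {y. \<forall>x\<in>L. x \<bullet> y \<in> \<int>}"

definition unimodular :: "(real ^ 'n) set \<Rightarrow> bool" where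
  "unimodular L \<longleftrightarrow> lattice_in L \<and> L = dual_lattice L"

definition even_normed :: "real ^ 'n \<Rightarrow> bool" where
  "even_normed x \<longleftrightarrow> (\<exists>k::int. x \<bullet> x = of_int (2 * k))"

definition even_unimodular :: "(real ^ 'n) set \<Rightarrow> bool" where
  "even_unimodular L \<longleftrightarrow> unimodular L \<and> (\<forall>x\<in>L. even_normed x)"

definition odd_unimodular :: "(real ^ 'n) set \<Rightarrow> bool" where
  "odd_unimodular L \<longleftrightarrow> unimodular L \<and> \<not> even_unimodular L"

text \<open>The infimum is attained when \<open>L\<close> is a nonzero lattice, since lattices are discrete.\<close>

definition min_norm :: "(real ^ 'n) set \<Rightarrow> real" where
  "min_norm L = (INF x\<in>L - {0}. x \<bullet> x)"

definition extremal_40 :: "(real ^ 40) set \<Rightarrow> bool" where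
  "extremal_40 L \<longleftrightarrow> unimodular L \<and> min_norm L = 4"

definition even_sublattice :: "(real ^ 'n) set \<Rightarrow> (real ^ 'n) set" where
  "even_sublattice L = {x \<in> L. even_normed x}"

definition shadow :: "(real ^ 'n) set \<Rightarrow> (real ^ 'n) set" where
  "shadow L = dual_lattice (even_sublattice L) - L"

text \<open>The theta series of \<open>X\<close>, the sum of \<open>q\<close> to the power \<open>x \<bullet> x\<close> over \<open>x \<in> X\<close>, is represented by
  its coefficients. Exponents are real, as norms of vectors in \<open>X\<close> need not be integers.\<close>

definition theta_series :: "(real ^ 'n) set \<Rightarrow> real \<Rightarrow> nat" where
  "theta_series X r = card {x \<in> X. x \<bullet> x = r}"

text \<open>The series \<open>1 + (19120 + 256 \<alpha>) q^4 + (1376256 - 4096 \<alpha>) q^5 + \<dots>\<close>, the dots standing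
  for terms with exponent greater than 5.\<close>

definition has_theta_series_40 :: "(real ^ 40) set \<Rightarrow> int \<Rightarrow> bool" where
  "has_theta_series_40 L \<alpha> \<longleftrightarrow>
     (\<forall>r\<le>5. int (theta_series L r) =
        (if r = 0 then 1
         else if r = 4 then 19120 + 256 * \<alpha>
         else if r = 5 then 1376256 - 4096 * \<alpha>
         else 0))"

end

theory Submission imports Defs begin

text \<open>
  The shadow is a single coset of \<open>L\<close> in the dual of the even sublattice, and \<open>L\<close> has index 2
  there. Hence the sum and the difference of any two shadow vectors lie in \<open>L\<close>
  (\<open>shadow_add_in_lattice\<close>, \<open>shadow_diff_in_lattice\<close>). If \<open>u\<close> and \<open>v\<close> are shadow vectors of
  norm 2 with \<open>u \<noteq> \<plusminus>v\<close>, then \<open>u + v\<close> and \<open>u - v\<close> are nonzero vectors of \<open>L\<close>, of norms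
  \<open>4 + 2 (u \<bullet> v)\<close> and \<open>4 - 2 (u \<bullet> v)\<close>. Both are at least 4, the minimum norm of \<open>L\<close>, so
  \<open>u \<bullet> v = 0\<close>. The shadow vectors of norm 2 therefore form pairs \<open>\<plusminus>u\<close> that are mutually orthogonal,
  that is, a part of an orthogonal frame of \<open>\<real>\<^sup>4\<^sup>0\<close>, and there are at most 40 such pairs
  (\<open>card_orthogonal_frame\<close>).
\<close>

lemma dual_lattice_add:
  "\<lbrakk>x \<in> dual_lattice L; y \<in> dual_lattice L\<rbrakk> \<Longrightarrow> x + y \<in> dual_lattice L"
  by (auto simp: dual_lattice_def inner_add_right)

lemma dual_lattice_uminus: "x \<in> dual_lattice L \<Longrightarrow> - x \<in> dual_lattice L"
  by (auto simp: dual_lattice_def)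

lemma unimodular_add: "\<lbrakk>unimodular L; x \<in> L; y \<in> L\<rbrakk> \<Longrightarrow> x + y \<in> L"
  using dual_lattice_add unfolding unimodular_def by metis

lemma unimodular_uminus: "\<lbrakk>unimodular L; x \<in> L\<rbrakk> \<Longrightarrow> - x \<in> L"
  using dual_lattice_uminus unfolding unimodular_def by metis

lemma unimodular_inner_Ints: "\<lbrakk>unimodular L; x \<in> L; y \<in> L\<rbrakk> \<Longrightarrow> x \<bullet> y \<in> \<int>"
  unfolding unimodular_def dual_lattice_def by blast

lemma unimodular_memI: "\<lbrakk>unimodular L; \<And>x. x \<in> L \<Longrightarrow> x \<bullet> y \<in> \<int>\<rbrakk> \<Longrightarrow> y \<in> L"
  unfolding unimodular_def dual_lattice_def by blast

text \<open>The even sublattice has index at most 2, because \<open>x \<bullet> x\<close> is additive modulo 2 on an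
  integral lattice.\<close>

lemma add_in_even_sublattice:
  assumes L: "unimodular L" and x: "x \<in> L - even_sublattice L" and y: "y \<in> L - even_sublattice L"
  shows "x + y \<in> even_sublattice L"
proof -
  have odd_norm: "\<exists>a. z \<bullet> z = of_int (2 * a + 1)" if z: "z \<in> L - even_sublattice L" for z
  proof -
    obtain k where k: "z \<bullet> z = of_int k"
      using unimodular_inner_Ints[OF L, of z z] z by (auto elim: Ints_cases)
    then have "odd k"
      using z by (auto simp: even_sublattice_def even_normed_def)
    then show ?thesis
      using k by (auto elim: oddE)
  qed
  obtain a b where a: "x \<bullet> x = of_int (2 * a + 1)" and b: "y \<bullet> y = of_int (2 * b + 1)"
    using odd_norm[OF x] odd_norm[OF y] by blast
  obtain c where c: "x \<bullet> y = of_int c"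
    using unimodular_inner_Ints[OF L, of x y] x y by (auto elim: Ints_cases)
  have "(x + y) \<bullet> (x + y) = of_int (2 * (a + b + c + 1))"
    using a b c by (simp add: inner_add_left inner_add_right inner_commute)
  then have "even_normed (x + y)"
    unfolding even_normed_def by blast
  then show ?thesis
    using x y unimodular_add[OF L] by (simp add: even_sublattice_def)
qed

text \<open>This describes the shadow as one coset: pairing with a shadow vector is, modulo 1, the
  same functional on \<open>L\<close> for all of them. It vanishes on the even sublattice, of index at most 2,
  but not on all of \<open>L\<close>, since the shadow vector is outside \<open>L\<close>, which is its own dual. So it has
  one nonzero value, and that value has order 2 modulo 1.\<close>

lemma shadow_inner:
  assumes L: "unimodular L" and u: "u \<in> shadow L" and y: "y \<in> L"
  shows "if y \<in> even_sublattice L then y \<bullet> u \<in> \<int> else y \<bullet> u - 1/2 \<in> \<int>"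
proof (cases "y \<in> even_sublattice L")
  case True
  then show ?thesis
    using u by (simp add: shadow_def dual_lattice_def)
next
  case False
  have dual: "z \<bullet> u \<in> \<int>" if "z \<in> even_sublattice L" for z
    using u that by (simp add: shadow_def dual_lattice_def)
  have "u \<notin> L"
    using u by (simp add: shadow_def)
  then obtain x where x: "x \<in> L" "x \<bullet> u \<notin> \<int>"
    using unimodular_memI[OF L] by blast
  then have "x \<in> L - even_sublattice L"
    using dual by blast
  then have "(x + y) \<bullet> u \<in> \<int>"
    using add_in_even_sublattice[OF L] y False dual by blast
  then have nonint: "y \<bullet> u \<notin> \<int>"
    using x Ints_diff[of "(x + y) \<bullet> u" "y \<bullet> u"] by (auto simp: inner_add_left)
  have "(y + y) \<bullet> u \<in> \<int>"
    using add_in_even_sublattice[OF L] y False dual by blast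
  then obtain k where "(y + y) \<bullet> u = of_int k"
    by (elim Ints_cases)
  then have k: "2 * (y \<bullet> u) = of_int k"
    unfolding inner_add_left by linarith
  have "odd k"
  proof
    assume "even k"
    then obtain m where "k = 2 * m"
      by (elim evenE)
    then have "y \<bullet> u = of_int m"
      using k by simp
    then show False
      using nonint by simp
  qed
  then obtain m where "k = 2 * m + 1"
    by (elim oddE)
  then have "y \<bullet> u - 1/2 = of_int m"
    using k by simp
  then show ?thesis
    using False by simp
qed

lemma shadow_diff_in_lattice:
  assumes L: "unimodular L" and u: "u \<in> shadow L" and v: "v \<in> shadow L"
  shows "u - v \<in> L"
proof (rule unimodular_memI[OF L])
  fix y assume y: "y \<in> L"
  show "y \<bullet> (u - v) \<in> \<int>"
    using shadow_inner[OF L u y] shadow_inner[OF L v y]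
      Ints_diff[of "y \<bullet> u" "y \<bullet> v"] Ints_diff[of "y \<bullet> u - 1/2" "y \<bullet> v - 1/2"]
    by (auto simp: inner_diff_right split: if_splits)
qed

lemma uminus_in_shadow:
  assumes L: "unimodular L" and u: "u \<in> shadow L"
  shows "- u \<in> shadow L"
  using u dual_lattice_uminus unimodular_uminus[OF L, of "- u"] by (auto simp: shadow_def)

lemma shadow_add_in_lattice:
  assumes "unimodular L" and "u \<in> shadow L" and "v \<in> shadow L"
  shows "u + v \<in> L"
  using shadow_diff_in_lattice[OF assms(1,2) uminus_in_shadow[OF assms(1,3)]] by simp

lemma min_norm_le:
  assumes "x \<in> L" and "x \<noteq> 0"
  shows "min_norm L \<le> x \<bullet> x"
  unfolding min_norm_def
proof (rule cINF_lower)
  show "bdd_below ((\<lambda>x. x \<bullet> x) ` (L - {0}))"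
    by (rule bdd_belowI[where m = 0]) auto
qed (use assms in auto)

text \<open>Writing \<open>m\<close> for half the minimum norm, \<open>u + v\<close> and \<open>u - v\<close> have norms \<open>2 m \<plusminus> 2 (u \<bullet> v)\<close>,
  and neither may fall below \<open>2 m\<close>.\<close>

lemma short_shadow_vectors_orthogonal:
  assumes L: "unimodular L" and u: "u \<in> shadow L" and v: "v \<in> shadow L"
    and norm_u: "2 * (u \<bullet> u) = min_norm L" and norm_v: "2 * (v \<bullet> v) = min_norm L"
    and "u \<noteq> v" and "u \<noteq> - v"
  shows "u \<bullet> v = 0"
proof -
  have "min_norm L \<le> (u - v) \<bullet> (u - v)"
    using shadow_diff_in_lattice[OF L u v] \<open>u \<noteq> v\<close> by (intro min_norm_le) auto
  moreover have "min_norm L \<le> (u + v) \<bullet> (u + v)"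
    using shadow_add_in_lattice[OF L u v] \<open>u \<noteq> - v\<close>
    by (intro min_norm_le) (auto simp: eq_neg_iff_add_eq_0)
  ultimately show ?thesis
    using norm_u norm_v
    by (simp add: inner_add_left inner_add_right inner_diff_left inner_diff_right inner_commute)
qed

text \<open>One vector from each pair \<open>\<plusminus>x\<close> gives an orthogonal set of nonzero vectors, which is
  linearly independent.\<close>

lemma card_orthogonal_frame:
  fixes A :: "'a::euclidean_space set"
  assumes neg: "\<And>x. x \<in> A \<Longrightarrow> - x \<in> A" and "0 \<notin> A"
    and orth: "\<And>x y. \<lbrakk>x \<in> A; y \<in> A; x \<noteq> y; x \<noteq> - y\<rbrakk> \<Longrightarrow> x \<bullet> y = 0"
  shows "even (card A)" and "card A \<le> 2 * DIM('a)"
proof -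
  define rep :: "'a \<Rightarrow> 'a" where "rep x = (SOME y. y = x \<or> y = - x)" for x
  define R where "R = rep ` A"
  have rep: "rep x = x \<or> rep x = - x" for x
    unfolding rep_def by (rule someI[of _ x]) simp
  have rep_uminus: "rep (- x) = rep x" for x
    unfolding rep_def by (simp add: disj_commute)
  have rep_R: "rep x = x" if "x \<in> R" for x
    using that rep rep_uminus unfolding R_def by (metis imageE)
  have "R \<subseteq> A"
    using rep neg unfolding R_def by (metis image_subsetI)
  then have "0 \<notin> R"
    using \<open>0 \<notin> A\<close> by blast
  have not_both: "- x \<notin> R" if "x \<in> R" for x
  proof
    assume "- x \<in> R"
    then have "- x = x"
      using that rep_R rep_uminus by metis
    then have "x \<bullet> x = - (x \<bullet> x)"
      using inner_minus_left[of x x] by simp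
    then show False
      using that \<open>0 \<notin> R\<close> by simp
  qed
  have "pairwise orthogonal R"
    unfolding pairwise_def orthogonal_def
    using orth \<open>R \<subseteq> A\<close> not_both by (metis subsetD)
  then have "independent R"
    using \<open>0 \<notin> R\<close> by (rule pairwise_orthogonal_independent)
  then have R: "finite R" "card R \<le> DIM('a)"
    using independent_bound by auto
  have "A = R \<union> uminus ` R"
  proof
    show "A \<subseteq> R \<union> uminus ` R"
    proof
      fix x assume "x \<in> A"
      then have "rep x \<in> R"
        by (simp add: R_def)
      moreover have "x = rep x \<or> x = - rep x"
        using rep[of x] by auto
      ultimately show "x \<in> R \<union> uminus ` R"
        using imageI[of "rep x" R uminus] by auto
    qed
    show "R \<union> uminus ` R \<subseteq> A"
      using \<open>R \<subseteq> A\<close> neg by auto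
  qed
  moreover have "R \<inter> uminus ` R = {}"
    using not_both by auto
  ultimately have "card A = 2 * card R"
    using R by (simp add: card_Un_disjoint card_image)
  then show "even (card A)" and "card A \<le> 2 * DIM('a)"
    using R by auto
qed

theorem lemma4p4:
  fixes L :: "(real ^ 40) set" and \<alpha> :: int
  assumes "extremal_40 L" and "odd_unimodular L"
    and "has_theta_series_40 L \<alpha>"
    and "\<alpha> = int (theta_series (shadow L) 2)"
  shows "even \<alpha> \<and> 0 \<le> \<alpha> \<and> \<alpha> \<le> 80"
proof -
  define A where "A = {x \<in> shadow L. x \<bullet> x = 2}"
  have L: "unimodular L" and min: "min_norm L = 4"
    using assms(1) by (auto simp: extremal_40_def)
  have neg: "- x \<in> A" if "x \<in> A" for x
    using that uminus_in_shadow[OF L] by (simp add: A_def)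
  have "0 \<notin> A"
    by (simp add: A_def)
  have orth: "x \<bullet> y = 0" if "x \<in> A" "y \<in> A" "x \<noteq> y" "x \<noteq> - y" for x y
    using that min by (intro short_shadow_vectors_orthogonal[OF L]) (auto simp: A_def)
  have "even (card A)" and "card A \<le> 2 * DIM(real ^ 40)"
    using card_orthogonal_frame[of A] neg \<open>0 \<notin> A\<close> orth by blast+
  moreover have "\<alpha> = int (card A)"
    using assms(4) by (simp add: theta_series_def A_def)
  ultimately show ?thesis
    by simp
qed

end
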